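(* Let $r$ be a positive integer with $r\equiv 0 \pmod 4$, let $Z_r$ be the cyclic group of order $r$, and let $G$ be an $r$-colorable nice graph. Then there exists a vertex-coloring $Z_r$-edge-weighting of $G$.
   Context: All graphs are finite, undirected and simple. A graph is nice if no connected component of it is a single edge ($K_2$). A graph is $r$-colorable if it has a proper vertex coloring with at most $r$ colors. For an abelian group $\Gamma$ (written additively), a $\Gamma$-edge-weighting of $G$ is a map $w:E(G)\to\Gamma$; it is vertex-coloring if the induced map $c(u)=\sum_{e\ni u}w(e)$ (sum in $\Gamma$ over edges $e$ incident with $u$) satisfies $c(u)\ne c(v)$ for every edge $uv\in E(G)$. *)

theory Defs
  imports "HOL-Algebra.Elementary_Groups" "HOL-Algebra.FiniteProduct" "HOL-Number_Theory.Cong"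
begin

text \<open>A graph is given by its vertex set and its set of edges, each edge being the
  two-element set of its ends.\<close>

definition simple_graph :: "'a set \<Rightarrow> 'a set set \<Rightarrow> bool" where
  "simple_graph V E \<longleftrightarrow> finite V \<and> (\<forall>e\<in>E. \<exists>u\<in>V. \<exists>v\<in>V. u \<noteq> v \<and> e = {u, v})"

definition reachable :: "'a set \<Rightarrow> 'a set set \<Rightarrow> ('a \<times> 'a) set" where
  "reachable V E = {(u, v). u \<in> V \<and> v \<in> V \<and> (u, v) \<in> {(x, y). {x, y} \<in> E}\<^sup>*}"

definition connected_components :: "'a set \<Rightarrow> 'a set set \<Rightarrow> ('a set \<times> 'a set set) set" where
  "connected_components V E = (\<lambda>C. (C, {e \<in> E. e \<subseteq> C})) ` (V // reachable V E)"

definition single_edge :: "'a set \<times> 'a set set \<Rightarrow> bool" where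
  "single_edge H \<longleftrightarrow> (\<exists>u v. u \<noteq> v \<and> H = ({u, v}, {{u, v}}))"

definition nice_graph :: "'a set \<Rightarrow> 'a set set \<Rightarrow> bool" where
  "nice_graph V E \<longleftrightarrow> (\<forall>H \<in> connected_components V E. \<not> single_edge H)"

definition proper_vertex_coloring :: "'a set \<Rightarrow> 'a set set \<Rightarrow> ('a \<Rightarrow> 'b) \<Rightarrow> bool" where
  "proper_vertex_coloring V E c \<longleftrightarrow> (\<forall>u\<in>V. \<forall>v\<in>V. {u, v} \<in> E \<longrightarrow> c u \<noteq> c v)"

definition colorable :: "nat \<Rightarrow> 'a set \<Rightarrow> 'a set set \<Rightarrow> bool" where
  "colorable r V E \<longleftrightarrow> (\<exists>c :: 'a \<Rightarrow> nat. proper_vertex_coloring V E c \<and> card (c ` V) \<le> r)"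

text \<open>The group is an abelian \<^const>\<open>comm_group\<close>, whose operation the library writes
  multiplicatively; so \<^const>\<open>finprod\<close> is the group's sum over a finite set.\<close>

definition edge_weighting ::
  "('g, 'm) monoid_scheme \<Rightarrow> 'a set set \<Rightarrow> ('a set \<Rightarrow> 'g) \<Rightarrow> bool" where
  "edge_weighting \<Gamma> E w \<longleftrightarrow> w \<in> E \<rightarrow> carrier \<Gamma>"

definition induced_color ::
  "('g, 'm) monoid_scheme \<Rightarrow> 'a set set \<Rightarrow> ('a set \<Rightarrow> 'g) \<Rightarrow> 'a \<Rightarrow> 'g" where
  "induced_color \<Gamma> E w u = finprod \<Gamma> w {e \<in> E. u \<in> e}"

definition vertex_coloring_edge_weighting ::
  "('g, 'm) monoid_scheme \<Rightarrow> 'a set \<Rightarrow> 'a set set \<Rightarrow> ('a set \<Rightarrow> 'g) \<Rightarrow> bool" where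
  "vertex_coloring_edge_weighting \<Gamma> V E w \<longleftrightarrow>
     edge_weighting \<Gamma> E w \<and> proper_vertex_coloring V E (induced_color \<Gamma> E w)"

end

theory Submission
  imports Defs "HOL-Combinatorics.Transposition"
begin

text \<open>
  Call an integer-valued function on the vertices realizable if, modulo \<open>r\<close>, it is the vector of
  vertex sums of some edge weighting. The realizable functions form a group, and it contains
  \<open>\<chi>\<^sub>u + \<chi>\<^sub>v\<close> for every edge \<open>uv\<close>, where \<open>\<chi>\<^sub>v\<close> is the indicator function of \<open>v\<close>. It
  suffices to find, on each connected component \<open>C\<close>, a realizable function supported on \<open>C\<close> that
  separates the ends of each edge of \<open>C\<close> modulo \<open>r\<close>: the sum of these functions is then the
  induced colouring of the required weighting.

  Fix a root \<open>x\<close> of \<open>C\<close>. Telescoping along a walk from \<open>x\<close> to \<open>v\<close> shows that \<open>\<chi>\<^sub>v - \<chi>\<^sub>x\<close> or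
  \<open>\<chi>\<^sub>v + \<chi>\<^sub>x\<close> is realizable, according to the parity of the length of the walk. So every function
  supported on \<open>C\<close> can be moved onto the root, up to a realizable function, and only a condition
  on a signed total remains. There are two cases.

  If \<open>2\<chi>\<^sub>x\<close> is realizable, every function with even total on \<open>C\<close> is realizable. The given
  colouring, with colours read as the integers below \<open>r\<close>, can be relabelled to have even total:
  exchanging two labels of different parity whose colour classes have sizes of different parity
  changes the parity of the total, and if no such pair exists then all class sizes have
  the same parity, so the total is congruent modulo 2 to a multiple of \<open>0 + \<dots> + (r - 1)\<close>,
  which is even because \<open>4\<close> divides \<open>r\<close> (lemma \<open>even_total_relabelling\<close>).

  If \<open>2\<chi>\<^sub>x\<close> is not realizable, the two possible signs split \<open>C\<close> into the two sides of a
  bipartition. A function that vanishes on one side and has only nonzero values with zero sum modulo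
  \<open>r\<close> on the other is realizable and separates the ends of edges. Such values exist on any side with at
  least two vertices (lemma \<open>nonzero_zero_sum\<close>). If both sides have at most one vertex, then \<open>C\<close>
  is an isolated vertex or a single edge, and the latter is excluded.
\<close>

section \<open>Realizable vertex sums\<close>

definition realizable :: "nat \<Rightarrow> 'a set \<Rightarrow> 'a set set \<Rightarrow> ('a \<Rightarrow> int) \<Rightarrow> bool" where
  "realizable r V E f \<longleftrightarrow>
     (\<exists>w. \<forall>v\<in>V. [f v = (\<Sum>e | e \<in> E \<and> v \<in> e. w e)] (mod int r))"

definition vertex_indicator :: "'a \<Rightarrow> 'a \<Rightarrow> int" where
  "vertex_indicator v u = of_bool (u = v)"

lemma finite_edges:
  assumes "simple_graph V E"
  shows "finite E"
proof -
  have "E \<subseteq> Pow V" "finite V" using assms by (auto simp: simple_graph_def)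
  then show ?thesis by (meson finite_Pow_iff finite_subset)
qed

lemma realizable_cong:
  assumes "realizable r V E f" and "\<And>v. v \<in> V \<Longrightarrow> [f v = g v] (mod int r)"
  shows "realizable r V E g"
  using assms unfolding realizable_def by (meson cong_sym cong_trans)

lemma realizable_zero: "realizable r V E (\<lambda>u. 0)"
  unfolding realizable_def by (rule exI[of _ "\<lambda>e. 0"]) simp

lemma realizable_add:
  assumes "realizable r V E f" and "realizable r V E g"
  shows "realizable r V E (\<lambda>u. f u + g u)"
proof -
  obtain w w' where "\<forall>v\<in>V. [f v = (\<Sum>e | e \<in> E \<and> v \<in> e. w e)] (mod int r)"
    and "\<forall>v\<in>V. [g v = (\<Sum>e | e \<in> E \<and> v \<in> e. w' e)] (mod int r)"
    using assms unfolding realizable_def by auto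
  then show ?thesis
    unfolding realizable_def
    by (intro exI[of _ "\<lambda>e. w e + w' e"]) (auto simp: sum.distrib intro: cong_add)
qed

lemma realizable_scale:
  assumes "realizable r V E f"
  shows "realizable r V E (\<lambda>u. k * f u)"
proof -
  obtain w where "\<forall>v\<in>V. [f v = (\<Sum>e | e \<in> E \<and> v \<in> e. w e)] (mod int r)"
    using assms unfolding realizable_def by auto
  then show ?thesis
    unfolding realizable_def
    by (intro exI[of _ "\<lambda>e. k * w e"])
       (auto simp: sum_distrib_left[symmetric] intro: cong_scalar_left)
qed

lemma realizable_diff:
  assumes "realizable r V E f" and "realizable r V E g"
  shows "realizable r V E (\<lambda>u. f u - g u)"
  using realizable_add[OF assms(1) realizable_scale[OF assms(2), of "-1"]] by simp

lemma realizable_sum: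
  assumes "\<And>i. i \<in> I \<Longrightarrow> realizable r V E (f i)"
  shows "realizable r V E (\<lambda>u. \<Sum>i\<in>I. f i u)"
  using assms
proof (induction I rule: infinite_finite_induct)
  case (insert i I)
  then show ?case using realizable_add[of r V E "f i"] by simp
qed (simp_all add: realizable_zero)

lemma realizable_edge:
  assumes "simple_graph V E" and "{u, v} \<in> E"
  shows "realizable r V E (\<lambda>z. vertex_indicator u z + vertex_indicator v z)"
proof -
  have uv: "u \<noteq> v" using assms unfolding simple_graph_def by (metis doubleton_eq_iff)
  have "(\<Sum>e | e \<in> E \<and> z \<in> e. of_bool (e = {u, v})) = vertex_indicator u z + vertex_indicator v z"
    for z
  proof -
    have "(\<Sum>e | e \<in> E \<and> z \<in> e. of_bool (e = {u, v}) :: int)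
        = (\<Sum>e | e \<in> E \<and> z \<in> e. if e = {u, v} then 1 else 0)"
      by (intro sum.cong) auto
    also have "\<dots> = (if z \<in> {u, v} then 1 else 0)"
      using finite_edges[OF assms(1)] assms(2) by (subst sum.delta) auto
    finally show ?thesis using uv by (auto simp: vertex_indicator_def)
  qed
  then show ?thesis
    unfolding realizable_def by (intro exI[of _ "\<lambda>e. of_bool (e = {u, v})"]) simp
qed

text \<open>If \<open>\<chi>\<^sub>v + s\<chi>\<^sub>x\<close> is realizable for each \<open>v \<in> C\<close>, then \<open>t\<close> restricted to \<open>C\<close> differs from a
  realizable function by a multiple of \<open>\<chi>\<^sub>x\<close> alone, so this multiple decides whether it is
  realizable.\<close>

lemma realizable_from_root:
  assumes "finite C"
    and "\<And>v. v \<in> C \<Longrightarrow> realizable r V E (\<lambda>z. vertex_indicator v z + s * vertex_indicator x z)"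
    and "realizable r V E (\<lambda>z. sum t C * vertex_indicator x z)"
  shows "realizable r V E (\<lambda>z. if z \<in> C then t z else 0)"
proof -
  have "realizable r V E
      (\<lambda>z. (\<Sum>v\<in>C. t v * (vertex_indicator v z + s * vertex_indicator x z))
            - s * (sum t C * vertex_indicator x z))"
    by (intro realizable_diff realizable_sum realizable_scale assms)
  moreover have "(\<Sum>v\<in>C. t v * (vertex_indicator v z + s * vertex_indicator x z))
      - s * (sum t C * vertex_indicator x z) = (if z \<in> C then t z else 0)" for z
  proof -
    have "(\<Sum>v\<in>C. t v * vertex_indicator v z) = (\<Sum>v\<in>C. if z = v then t v else 0)"
      by (intro sum.cong) (auto simp: vertex_indicator_def)
    also have "\<dots> = (if z \<in> C then t z else 0)" using assms(1) by simp
    finally show ?thesis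
      by (simp add: distrib_left sum.distrib sum_distrib_right sum_distrib_left mult.left_commute
          mult.assoc)
  qed
  ultimately show ?thesis by simp
qed

section \<open>The choice of colours\<close>

text \<open>Give all elements but two the value \<open>1\<close>. Of these two, one gets \<open>1\<close> or \<open>2\<close> and the other
  the value that makes the sum zero. The choices \<open>1\<close> and \<open>2\<close> lead to consecutive values there,
  which are not both multiples of \<open>m\<close>, so one of the two choices works.\<close>

lemma nonzero_zero_sum:
  fixes m :: int
  assumes "3 \<le> m" and "finite A" and "2 \<le> card A"
  shows "\<exists>t. (\<forall>v\<in>A. \<not> m dvd t v) \<and> m dvd sum t A"
proof -
  obtain a b where ab: "a \<in> A" "b \<in> A" "a \<noteq> b"
    using assms(2,3) by (metis card_le_Suc0_iff_eq not_less_eq_eq numeral_2_eq_2)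
  define s where "s = int (card (A - {a, b}))"
  have nd: "\<not> m dvd 1" "\<not> m dvd 2" using assms(1) by (auto dest!: zdvd_imp_le)
  have "\<not> (m dvd - s - 1 \<and> m dvd - s - 2)"
    using nd(1) dvd_diff[of m "- s - 1" "- s - 2"] by auto
  then obtain p where p: "\<not> m dvd p" "\<not> m dvd - s - p" using nd by blast
  define t where "t v = (if v = a then p else if v = b then - s - p else 1)" for v
  have "sum t A = t a + t b + sum t (A - {a, b})"
    using ab assms(2)
    by (simp add: sum.remove[of A a] sum.remove[of "A - {a}" b] Diff_insert[symmetric] insert_commute)
  also have "sum t (A - {a, b}) = s" by (simp add: t_def s_def)
  finally have "sum t A = 0" using ab by (simp add: t_def)
  then show ?thesis using p nd by (intro exI[of _ t]) (auto simp: t_def)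
qed

lemma sum_transpose_labels:
  fixes c :: "'a \<Rightarrow> nat"
  assumes "finite C" and "i \<noteq> j"
  shows "(\<Sum>v\<in>C. int (transpose i j (c v))) = (\<Sum>v\<in>C. int (c v))
    + (int j - int i) * (int (card {v\<in>C. c v = i}) - int (card {v\<in>C. c v = j}))"
proof -
  have "(\<Sum>v\<in>C. int (transpose i j (c v))) =
     (\<Sum>v\<in>C. int (c v) + ((int j - int i) * of_bool (c v = i) - (int j - int i) * of_bool (c v = j)))"
    using assms(2) by (intro sum.cong) (auto simp: transpose_def)
  also have "\<dots> = (\<Sum>v\<in>C. int (c v)) + ((int j - int i) * (\<Sum>v\<in>C. of_bool (c v = i))
     - (int j - int i) * (\<Sum>v\<in>C. of_bool (c v = j)))"
    by (simp add: sum.distrib sum_subtractf sum_distrib_left)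
  finally show ?thesis
    using assms(1) by (simp add: sum_of_bool_eq Int_def right_diff_distrib)
qed

lemma even_total_of_equal_parities:
  fixes c :: "'a \<Rightarrow> nat"
  assumes "4 dvd r" and "finite C" and "c ` C \<subseteq> {..<r}"
    and "\<And>i j. i < r \<Longrightarrow> j < r \<Longrightarrow> even (card {v\<in>C. c v = i}) = even (card {v\<in>C. c v = j})"
  shows "even (\<Sum>v\<in>C. c v)"
proof -
  define n where "n i = card {v\<in>C. c v = i}" for i
  have "(\<Sum>v\<in>C. c v) = (\<Sum>i<r. \<Sum>v | v \<in> C \<and> c v = i. c v)"
    using assms(2,3) by (intro sum.group[symmetric]) auto
  also have "\<dots> = (\<Sum>i<r. i * n i)" by (intro sum.cong) (auto simp: n_def)
  finally have total: "(\<Sum>v\<in>C. c v) = (\<Sum>i<r. i * n i)" .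
  have "even (\<Sum>i<r. i * n i) = even (\<Sum>i<r. i * n 0)"
  proof -
    have "{i. i < r \<and> odd (i * n i)} = {i. i < r \<and> odd (i * n 0)}"
      using assms(4) unfolding n_def[symmetric]
      by (metis (lifting) bot_nat_0.not_eq_extremum even_mult_iff not_less_zero less_trans)
    then show ?thesis by (simp add: even_sum_iff lessThan_def)
  qed
  moreover have "even (\<Sum>i<r. i)"
  proof -
    obtain k where "r = 4 * k" using assms(1) by blast
    then have "(\<Sum>i<r. i) = 2 * (k * (r - 1))"
      using gauss_sum_nat[of "r - 1"]
      by (cases "r = 0") (auto simp: lessThan_Suc_atMost[symmetric] atMost_atLeast0[symmetric])
    then show ?thesis by simp
  qed
  ultimately show ?thesis by (simp add: total sum_distrib_right[symmetric])
qed

text \<open>Exchanging the labels \<open>i\<close> and \<open>j\<close> changes the total by the product of the differences of the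
  labels and of the class sizes, so the parity of the total changes if both are odd. If
  some two classes \<open>a\<close>, \<open>b\<close> have sizes of different parity but labels of equal parity, any third
  label of the other parity can be exchanged with one of them.\<close>

lemma even_total_relabelling:
  fixes c :: "'a \<Rightarrow> nat"
  assumes "4 dvd r" and "finite C" and "c ` C \<subseteq> {..<r}"
  shows "\<exists>\<sigma>. inj_on \<sigma> {..<r} \<and> \<sigma> ` {..<r} \<subseteq> {..<r} \<and> even (\<Sum>v\<in>C. int (\<sigma> (c v)))"
proof (cases "even (\<Sum>v\<in>C. int (c v))")
  case True
  then show ?thesis by (intro exI[of _ id]) auto
next
  case False
  define n where "n i = card {v\<in>C. c v = i}" for i
  have "odd (\<Sum>v\<in>C. c v)" using False by (simp flip: of_nat_sum)
  then obtain a b where ab: "a < r" "b < r" "even (n a) \<noteq> even (n b)"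
    using even_total_of_equal_parities[OF assms] unfolding n_def by blast
  obtain i j where ij: "i < r" "j < r" "even i \<noteq> even j" "even (n i) \<noteq> even (n j)"
  proof (cases "even a = even b")
    case True
    have "even r" using assms(1) by (auto simp: dvd_def)
    \<comment> \<open>The label \<open>d\<close> is the partner of \<open>a\<close> in the pairing \<open>{0, 1}, {2, 3}, \<dots>\<close>, which
      stays below \<open>r\<close> because \<open>r\<close> is even.\<close>
    define d where "d = (if even a then a + 1 else a - 1)"
    have d: "d < r" "even d \<noteq> even a" using ab(1) \<open>even r\<close>
      by (auto simp: d_def) (metis Suc_lessI even_Suc)
    show ?thesis
      using that[of a d] that[of b d] ab d True by metis
  qed (use that ab in blast)
  have "i \<noteq> j" using ij(3) by auto
  have "even (\<Sum>v\<in>C. int (transpose i j (c v)))"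
    using False ij(3,4) unfolding sum_transpose_labels[OF assms(2) \<open>i \<noteq> j\<close>] n_def by simp
  moreover have "transpose i j ` {..<r} \<subseteq> {..<r}" using ij(1,2) by (auto simp: transpose_def)
  ultimately show ?thesis
    by (intro exI[of _ "transpose i j"]) (auto intro: inj_onI dest: transpose_eq_imp_eq)
qed

section \<open>Components\<close>

abbreviation component_of :: "'a set \<Rightarrow> 'a set set \<Rightarrow> 'a \<Rightarrow> 'a set" where
  "component_of V E x \<equiv> reachable V E `` {x}"

lemma equiv_reachable: "equiv V (reachable V E)"
proof (rule equivI)
  have "sym {(x, y). {x, y} \<in> E}" by (auto simp: sym_def insert_commute)
  then have "sym ({(x, y). {x, y} \<in> E}\<^sup>*)" by (rule sym_rtrancl)
  then show "sym (reachable V E)" by (auto simp: reachable_def sym_def)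
qed (auto simp: reachable_def refl_on_def trans_def)

lemma edge_reachable:
  assumes "simple_graph V E" and "{u, v} \<in> E"
  shows "(u, v) \<in> reachable V E"
proof -
  obtain a b where "a \<in> V" "b \<in> V" "{u, v} = {a, b}"
    using assms unfolding simple_graph_def by blast
  then have "u \<in> V" "v \<in> V" by (auto simp: doubleton_eq_iff)
  then show ?thesis using assms(2) by (auto simp: reachable_def)
qed

text \<open>Crossing an edge \<open>uv\<close> reverses the sign, because
  \<open>(\<chi>\<^sub>u + \<chi>\<^sub>v) - (\<chi>\<^sub>u \<plusminus> \<chi>\<^sub>x) = \<chi>\<^sub>v \<minusplus> \<chi>\<^sub>x\<close>.\<close>

lemma realizable_across_edge:
  assumes "simple_graph V E" and "{u, v} \<in> E"
    and "realizable r V E (\<lambda>z. vertex_indicator u z + s * vertex_indicator x z)"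
  shows "realizable r V E (\<lambda>z. vertex_indicator v z + (- s) * vertex_indicator x z)"
  using realizable_diff[OF realizable_edge[OF assms(1,2), of r] assms(3)] by simp

lemma component_signs:
  assumes "simple_graph V E" and "v \<in> component_of V E x"
  shows "realizable r V E (\<lambda>z. vertex_indicator v z + 1 * vertex_indicator x z)
       \<or> realizable r V E (\<lambda>z. vertex_indicator v z + (- 1) * vertex_indicator x z)"
proof -
  have "(x, v) \<in> {(x, y). {x, y} \<in> E}\<^sup>*" using assms(2) by (auto simp: reachable_def)
  then show ?thesis
  proof (induction rule: rtrancl_induct)
    case base
    then show ?case by (simp add: realizable_zero)
  next
    case (step y z)
    then show ?case
      using realizable_across_edge[OF assms(1), of y z r 1 x]
        realizable_across_edge[OF assms(1), of y z r "-1" x] by auto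
  qed
qed

definition separates_edges :: "nat \<Rightarrow> 'a set \<Rightarrow> 'a set set \<Rightarrow> ('a \<Rightarrow> int) \<Rightarrow> bool" where
  "separates_edges r C E t \<longleftrightarrow>
     (\<forall>u\<in>C. \<forall>v\<in>C. {u, v} \<in> E \<longrightarrow> \<not> [t u = t v] (mod int r))"

text \<open>Adding \<open>2\<chi>\<^sub>x\<close> turns the sign \<open>-\<close> into \<open>+\<close>, so every vertex can be moved to the root
  with the same sign. The coefficient left at the root is then the total, and a multiple of
  \<open>2\<chi>\<^sub>x\<close> removes it as soon as it is even.\<close>

lemma separating_function_even_case:
  assumes "4 dvd r" and "simple_graph V E" and "x \<in> V"
    and "proper_vertex_coloring V E c" and "c ` V \<subseteq> {..<r}"
    and two: "realizable r V E (\<lambda>z. 2 * vertex_indicator x z)"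
  shows "\<exists>t. realizable r V E (\<lambda>z. if z \<in> component_of V E x then t z else 0)
    \<and> separates_edges r (component_of V E x) E t"
proof -
  define C where "C = component_of V E x"
  have CV: "C \<subseteq> V" by (auto simp: C_def reachable_def)
  have fin: "finite C" using CV assms(2) finite_subset by (auto simp: simple_graph_def)
  obtain \<sigma> where s: "inj_on \<sigma> {..<r}" "\<sigma> ` {..<r} \<subseteq> {..<r}" "even (\<Sum>v\<in>C. int (\<sigma> (c v)))"
    using even_total_relabelling[OF assms(1) fin subset_trans[OF image_mono[OF CV] assms(5)]]
    by blast
  define t where "t v = int (\<sigma> (c v))" for v
  have plus: "realizable r V E (\<lambda>z. vertex_indicator v z + 1 * vertex_indicator x z)"
    if v: "v \<in> C" for v
    using component_signs[OF assms(2) v[unfolded C_def], of r]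
  proof
    assume "realizable r V E (\<lambda>z. vertex_indicator v z + (- 1) * vertex_indicator x z)"
    from realizable_add[OF this two] show ?thesis by (simp add: algebra_simps)
  qed
  obtain k where "sum t C = k * 2" using s(3) by (auto simp: t_def elim: evenE)
  then have "realizable r V E (\<lambda>z. sum t C * vertex_indicator x z)"
    using realizable_scale[OF two, of k] by (simp add: mult.assoc)
  with realizable_from_root[OF fin plus]
  have "realizable r V E (\<lambda>z. if z \<in> C then t z else 0)" by blast
  moreover have "separates_edges r C E t"
    unfolding separates_edges_def
  proof (intro ballI impI notI)
    fix u v assume uv: "u \<in> C" "v \<in> C" "{u, v} \<in> E" and "[t u = t v] (mod int r)"
    have lt: "c u < r" "c v < r" using uv CV assms(5) by auto
    then have "\<sigma> (c u) < r" "\<sigma> (c v) < r" using s(2) by auto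
    then have "\<sigma> (c u) = \<sigma> (c v)"
      using \<open>[t u = t v] (mod int r)\<close> by (simp add: t_def cong_int_iff cong_less_modulus_unique_nat)
    then have "c u = c v" using s(1) lt by (simp add: inj_on_eq_iff)
    then show False using uv CV assms(4) by (auto simp: proper_vertex_coloring_def)
  qed
  ultimately show ?thesis unfolding C_def by blast
qed

text \<open>Here \<open>A\<close> is one side of a bipartition of \<open>C\<close>, all of whose vertices can be moved to the
  root with the same sign \<open>s\<close>; a zero sum over \<open>A\<close> modulo \<open>r\<close> leaves nothing at the root.\<close>

lemma separating_function_one_side:
  assumes "3 \<le> r" and "finite A" and "2 \<le> card A" and "A \<subseteq> C"
    and "\<And>v. v \<in> A \<Longrightarrow> realizable r V E (\<lambda>z. vertex_indicator v z + s * vertex_indicator x z)"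
    and one: "\<And>u v. u \<in> C \<Longrightarrow> v \<in> C \<Longrightarrow> {u, v} \<in> E \<Longrightarrow> u \<in> A \<longleftrightarrow> v \<notin> A"
  shows "\<exists>t. realizable r V E (\<lambda>z. if z \<in> C then t z else 0) \<and> separates_edges r C E t"
proof -
  obtain t where t: "\<forall>v\<in>A. \<not> int r dvd t v" "int r dvd sum t A"
    using nonzero_zero_sum[of "int r" A] assms(1-3) by auto
  define t' where "t' v = (if v \<in> A then t v else 0)" for v
  have "realizable r V E (\<lambda>z. sum t A * vertex_indicator x z)"
    by (rule realizable_cong[OF realizable_zero]) (use t(2) in \<open>auto simp: cong_def\<close>)
  with realizable_from_root[OF assms(2,5)] have "realizable r V E t'"
    unfolding t'_def by blast
  moreover have "(\<lambda>z. if z \<in> C then t' z else 0) = t'"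
    using assms(4) by (auto simp: t'_def intro!: ext)
  moreover have "separates_edges r C E t'"
    unfolding separates_edges_def
  proof (intro ballI impI)
    fix u v assume "u \<in> C" "v \<in> C" "{u, v} \<in> E"
    from one[OF this] t(1) show "\<not> [t' u = t' v] (mod int r)"
      by (cases "u \<in> A") (auto simp: t'_def cong_0_iff cong_sym_eq[of 0])
  qed
  ultimately show ?thesis by (intro exI[of _ t']) simp
qed

text \<open>The sides of the bipartition are the vertices that can be moved to the root with sign \<open>1\<close>
  and with sign \<open>- 1\<close>. They are disjoint, since otherwise a difference would realize \<open>2\<chi>\<^sub>x\<close>,
  and every edge joins one to the other.\<close>

lemma separating_function_bipartite_case:
  assumes "3 \<le> r" and G: "simple_graph V E" and "nice_graph V E" and "x \<in> V"
    and two: "\<not> realizable r V E (\<lambda>z. 2 * vertex_indicator x z)"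
  shows "\<exists>t. realizable r V E (\<lambda>z. if z \<in> component_of V E x then t z else 0)
    \<and> separates_edges r (component_of V E x) E t"
proof -
  define C where "C = component_of V E x"
  have CV: "C \<subseteq> V" by (auto simp: C_def reachable_def)
  have fin: "finite C" using CV G finite_subset by (auto simp: simple_graph_def)
  define side where "side s = {v\<in>C. realizable r V E
    (\<lambda>z. vertex_indicator v z + s * vertex_indicator x z)}" for s
  have cover: "C = side 1 \<union> side (- 1)"
    using component_signs[OF G] unfolding side_def C_def by blast
  have disj: "side 1 \<inter> side (- 1) = {}"
  proof (rule ccontr)
    assume "\<not> ?thesis"
    then obtain v where "realizable r V E (\<lambda>z. vertex_indicator v z + 1 * vertex_indicator x z)"
      "realizable r V E (\<lambda>z. vertex_indicator v z + (- 1) * vertex_indicator x z)"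
      unfolding side_def by blast
    from realizable_diff[OF this] show False using two by (simp add: algebra_simps)
  qed
  have cross: "v \<in> side (- s)" if "u \<in> side s" "v \<in> C" "{u, v} \<in> E" for u v s
    using that realizable_across_edge[OF G, of u v r s x] unfolding side_def by simp
  have other: "u \<in> side 1 \<longleftrightarrow> v \<notin> side 1" "u \<in> side (- 1) \<longleftrightarrow> v \<notin> side (- 1)"
    if "u \<in> C" "v \<in> C" "{u, v} \<in> E" for u v
    using cross[of u 1 v] cross[of u "-1" v] that cover disj by auto
  have fins: "finite (side s)" "side s \<subseteq> C" for s using fin by (auto simp: side_def)
  have root: "x \<in> side (- 1)"
    using assms(4) by (auto simp: side_def C_def reachable_def realizable_zero)
  consider "2 \<le> card (side 1)" | "2 \<le> card (side (- 1))"
    | "card (side 1) \<le> 1" "card (side (- 1)) \<le> 1" by linarith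
  then show ?thesis
  proof cases
    case 1
    show ?thesis
      using separating_function_one_side[OF assms(1) fins(1) 1 fins(2),
          where V = V and E = E and s = 1 and x = x] other(1)
      unfolding C_def[symmetric] by (auto simp: side_def)
  next
    case 2
    show ?thesis
      using separating_function_one_side[OF assms(1) fins(1) 2 fins(2),
          where V = V and E = E and s = "- 1" and x = x] other(2)
      unfolding C_def[symmetric] by (auto simp: side_def)
  next
    case 3
    have A: "side (- 1) = {x}"
      using 3(2) root fins(1)[of "-1"] by (auto simp: card_le_Suc0_iff_eq)
    \<comment> \<open>An edge inside \<open>C\<close> would use up both sides, so \<open>C\<close> would be a single edge.\<close>
    have no_edge: "{u, v} \<notin> E" if "u \<in> C" "v \<in> C" for u v
    proof
      assume uv: "{u, v} \<in> E"
      have "u = x \<longleftrightarrow> v \<noteq> x" using other(2)[OF that uv] A by simp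
      then obtain y where xy: "{x, y} \<in> E" and "y \<in> C" "y \<noteq> x"
        using uv \<open>u \<in> C\<close> \<open>v \<in> C\<close> by (metis insert_commute)
      then have y: "y \<in> side 1" using cover A by blast
      have "side 1 = {y}"
        using 3(1) y fins(1)[of 1] by (auto simp: card_le_Suc0_iff_eq)
      then have C: "C = {x, y}" using cover A by auto
      have ne: "x \<noteq> y" using y disj root by auto
      have "{e \<in> E. e \<subseteq> {x, y}} = {{x, y}}"
      proof (intro equalityI subsetI)
        fix e assume e: "e \<in> {e \<in> E. e \<subseteq> {x, y}}"
        then obtain a b where "a \<noteq> b" "e = {a, b}" using G by (auto simp: simple_graph_def)
        then show "e \<in> {{x, y}}" using e by auto
      qed (use xy in auto)
      then have "single_edge (C, {e \<in> E. e \<subseteq> C})" using ne C by (auto simp: single_edge_def)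
      moreover have "(C, {e \<in> E. e \<subseteq> C}) \<in> connected_components V E"
        using assms(4) by (auto simp: connected_components_def C_def quotient_def)
      ultimately show False using assms(3) by (auto simp: nice_graph_def)
    qed
    then have "separates_edges r C E (\<lambda>z. 0)" by (auto simp: separates_edges_def)
    then show ?thesis
      unfolding C_def[symmetric] by (intro exI[of _ "\<lambda>z. 0"]) (simp add: realizable_zero)
  qed
qed

section \<open>Assembling the weighting\<close>

lemma realizable_separating_function:
  assumes G: "simple_graph V E"
    and comp: "\<And>x. x \<in> V \<Longrightarrow> \<exists>t. realizable r V E (\<lambda>z. if z \<in> component_of V E x then t z else 0)
      \<and> separates_edges r (component_of V E x) E t"
  shows "\<exists>T. realizable r V E T \<and> separates_edges r V E T"
proof -
  let ?Q = "V // reachable V E"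
  have "\<exists>t. realizable r V E (\<lambda>z. if z \<in> C then t z else 0) \<and> separates_edges r C E t"
    if "C \<in> ?Q" for C
    using that comp by (auto elim!: quotientE)
  then obtain t where t: "\<And>C. C \<in> ?Q \<Longrightarrow> realizable r V E (\<lambda>z. if z \<in> C then t C z else 0)"
    "\<And>C. C \<in> ?Q \<Longrightarrow> separates_edges r C E (t C)"
    by metis
  define T where "T z = (\<Sum>C\<in>?Q. if z \<in> C then t C z else 0)" for z
  have finQ: "finite ?Q"
    using G by (auto simp: simple_graph_def reachable_def intro!: finite_quotient)
  have T: "T z = t (component_of V E z) z" if z: "z \<in> V" for z
  proof -
    have "z \<in> C \<longleftrightarrow> C = component_of V E z" if "C \<in> ?Q" for C
      using that z equiv_class_eq_iff[OF equiv_reachable[of V E]]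
        equiv_class_self[OF equiv_reachable[of V E] z] by (auto elim!: quotientE)
    then have "T z = (\<Sum>C\<in>?Q. if C = component_of V E z then t C z else 0)"
      unfolding T_def by (intro sum.cong) auto
    also have "\<dots> = t (component_of V E z) z"
      using finQ z by (simp add: quotientI)
    finally show ?thesis .
  qed
  have "realizable r V E T" unfolding T_def by (intro realizable_sum t)
  moreover have "separates_edges r V E T"
    unfolding separates_edges_def
  proof (intro ballI impI)
    fix u v assume uv: "u \<in> V" "v \<in> V" "{u, v} \<in> E"
    let ?C = "component_of V E u"
    have same: "component_of V E v = ?C"
      using edge_reachable[OF G uv(3)] equiv_class_eq[OF equiv_reachable] by metis
    have "u \<in> ?C" "v \<in> ?C"
      using edge_reachable[OF G uv(3)] equiv_class_self[OF equiv_reachable uv(1)] by auto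
    then have "\<not> [t ?C u = t ?C v] (mod int r)"
      using t(2)[of ?C] uv by (auto simp: separates_edges_def quotientI)
    then show "\<not> [T u = T v] (mod int r)" using T uv same by simp
  qed
  ultimately show ?thesis by blast
qed

lemma finprod_integer_mod_group:
  assumes "r > 0" and "finite S"
  shows "finprod (integer_mod_group r) (\<lambda>e. w e mod int r) S = sum w S mod int r"
proof -
  interpret comm_group "integer_mod_group r" by (rule abelian_integer_mod_group)
  show ?thesis
    using assms(2)
  proof (induction S rule: finite_induct)
    case (insert e S)
    have "(\<lambda>e. w e mod int r) \<in> insert e S \<rightarrow> carrier (integer_mod_group r)"
      using assms(1) by (auto simp: carrier_integer_mod_group)
    with insert show ?case by (simp add: Pi_iff mult_integer_mod_group mod_add_eq)
  qed simp
qed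

lemma vertex_coloring_edge_weighting_of_realizable:
  assumes "r > 0" and "simple_graph V E" and "realizable r V E T" and "separates_edges r V E T"
  shows "\<exists>w. vertex_coloring_edge_weighting (integer_mod_group r) V E w"
proof -
  obtain w where w: "\<And>v. v \<in> V \<Longrightarrow> [T v = (\<Sum>e | e \<in> E \<and> v \<in> e. w e)] (mod int r)"
    using assms(3) unfolding realizable_def by blast
  define w' where "w' e = w e mod int r" for e
  have "induced_color (integer_mod_group r) E w' v = T v mod int r" if "v \<in> V" for v
    using w[OF that] finite_edges[OF assms(2)]
    unfolding induced_color_def w'_def by (simp add: finprod_integer_mod_group[OF assms(1)] cong_def)
  then have "proper_vertex_coloring V E (induced_color (integer_mod_group r) E w')"
    using assms(4) by (auto simp: proper_vertex_coloring_def separates_edges_def cong_def)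
  moreover have "edge_weighting (integer_mod_group r) E w'"
    using assms(1) by (auto simp: edge_weighting_def w'_def carrier_integer_mod_group)
  ultimately show ?thesis unfolding vertex_coloring_edge_weighting_def by blast
qed

lemma colorable_below:
  assumes "colorable r V E" and "finite V"
  shows "\<exists>c. proper_vertex_coloring V E c \<and> c ` V \<subseteq> {..<r}"
proof -
  obtain c :: "'a \<Rightarrow> nat" where c: "proper_vertex_coloring V E c" "card (c ` V) \<le> r"
    using assms(1) by (auto simp: colorable_def)
  obtain h where h: "h ` (c ` V) \<subseteq> {..<r}" "inj_on h (c ` V)"
    using card_le_inj[of "c ` V" "{..<r}"] assms(2) c(2) by auto
  have "proper_vertex_coloring V E (h \<circ> c)"
    using c(1) h(2) by (auto simp: proper_vertex_coloring_def inj_on_eq_iff)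
  then show ?thesis using h(1) by (intro exI[of _ "h \<circ> c"]) (auto simp: image_comp)
qed

theorem theorem4p1:
  fixes r :: nat and V :: "'a set" and E :: "'a set set"
  assumes "r > 0" and "[r = 0] (mod 4)"
    and "simple_graph V E" and "nice_graph V E" and "colorable r V E"
  shows "\<exists>w. vertex_coloring_edge_weighting (integer_mod_group r) V E w"
proof -
  have r: "4 dvd r" "3 \<le> r" using assms(1,2) by (auto simp: cong_0_iff dest: dvd_imp_le)
  obtain c where c: "proper_vertex_coloring V E c" "c ` V \<subseteq> {..<r}"
    using colorable_below[OF assms(5)] assms(3) by (auto simp: simple_graph_def)
  have "\<exists>t. realizable r V E (\<lambda>z. if z \<in> component_of V E x then t z else 0)
      \<and> separates_edges r (component_of V E x) E t" if x: "x \<in> V" for x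
    using separating_function_even_case[OF r(1) assms(3) x c]
      separating_function_bipartite_case[OF r(2) assms(3,4) x] by blast
  then obtain T where "realizable r V E T" "separates_edges r V E T"
    using realizable_separating_function[OF assms(3)] by meson
  with assms(1,3) show ?thesis by (rule vertex_coloring_edge_weighting_of_realizable)
qed

end
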